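(* Let $\{N(\omega,t),\boldsymbol{F},\boldsymbol{P}\}$ be a process that is both a Cox process and a Hawkes process with baseline intensity $\mu$ and self-exciting function $\phi$. Then $\phi\equiv0$.
   Context: $(\boldsymbol{\varOmega},\mathscr{F},\boldsymbol{P})$ is a probability space with filtration $\boldsymbol{F}=\{\mathscr{F}_t:t\geq0\}$. A simple point process is a process $N(\omega,t)$, $t\ge 0$, that is (P0) $\boldsymbol{F}$-adapted and such that for fixed $\omega$ its path is (P1) right-continuous, (P2) non-decreasing, (P3) integer-valued, (P4) satisfies $N(\omega,0)=0$, (P5) has jumps $N(\omega,s)-N(\omega,s-)\in\{0,1\}$. Its compensator is the unique predictable non-decreasing process $A(\omega,t)$ with $A(\omega,0)=0$ such that $N-A$ is an $\boldsymbol{F}$-local martingale. A Cox process is a simple point process $N$ characterized by its compensator $A$ as follows: (C0) $N(\omega,t)$ and $A(\omega,t)$ are adapted to $\boldsymbol{F}$; (C1) $\mathscr{F}_0$ contains the $\sigma$-algebra generated by all $A(\cdot,t)$, $t\geq0$; (C2) for $0\leq s<t$ and $n=0,1,2,\dots$, $$\boldsymbol{P}(N(\cdot,t)-N(\cdot,s)=n\mid\mathscr{F}_s)(\omega)=\frac{(A(\omega,t)-A(\omega,s))^n e^{A(\omega,s)-A(\omega,t)}}{n!};$$ (C3) for $0\leq s<t\leq u<v$, the random variables $N(\cdot,t)-N(\cdot,s)$ and $N(\cdot,u)-N(\cdot,v)$ are conditionally independent given $\mathscr{F}_0$. A simple point process is orderly if for any stopping time $\tau\geq0$, $\lim_{h\to0}\frac1h\boldsymbol{P}(N(\cdot,\tau+h)-N(\cdot,\tau)>1\mid\mathscr{F}_\tau)=0$.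 The intensity $\lambda(\omega,t)$ of an orderly point process $N$ is a non-negative process such that for any predictable stopping time $\tau\geq0$, $\lim_{h\to0}\frac1h\boldsymbol{P}(N(\cdot,\tau+h)-N(\cdot,\tau)=1\mid\mathscr{F}_\tau)(\omega)=\lambda(\omega,\tau(\omega))$. Here $\mathscr{F}_\tau=\{B: B\cap\{\tau\leq t\}\in\mathscr{F}_t\text{ for all }t\geq0\}$. A Hawkes process is a simple point process $N$ with arrivals at times $0=T_0(\omega)<T_1(\omega)<T_2(\omega)<\cdots$ whose intensity satisfies $$\lambda(\omega,t)=\mu(t)+\sum_{n:T_n(\omega)<t}\phi(t-T_n(\omega)),$$ where $\mu$ (the baseline intensity) is a non-negative locally integrable function on $[0,\infty)$, and $\phi$ (the self-exciting function) is a non-negative continuous function on $[0,\infty)$ with $\int_0^\infty\phi(t)\,dt<\infty$ and $\phi(t)=0$ for $t<0$. *)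

theory Defs
  imports "HOL-Probability.Probability"
begin

text \<open>Time is \<open>[0,\<infinity>)\<close>, represented inside \<open>real\<close>. A filtration
  given on \<open>[0,\<infinity>)\<close> extends to \<open>real\<close> by \<open>F t = F 0\<close> for \<open>t < 0\<close>; negative times are
  otherwise irrelevant, since processes are only constrained at times \<open>t \<ge> 0\<close> and for
  \<open>\<tau> \<ge> 0\<close> the conditions in \<open>stopping_time F \<tau>\<close> and \<open>filtration.pre_sigma\<close>
  are trivial at \<open>t < 0\<close>.\<close>

locale filtered_prob_space = prob_space M + filtration "space M" F
  for M :: "'a measure" and F :: "real \<Rightarrow> 'a measure" +
  assumes subalgebra_F: "\<And>t. subalgebra M (F t)"

definition adapted :: "(real \<Rightarrow> 'a measure) \<Rightarrow> (real \<Rightarrow> 'a \<Rightarrow> real) \<Rightarrow> bool" where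
  "adapted F X \<longleftrightarrow> (\<forall>t\<ge>0. X t \<in> borel_measurable (F t))"


subsection \<open>Predictability and local martingales\<close>

definition predictable_algebra ::
    "'a measure \<Rightarrow> (real \<Rightarrow> 'a measure) \<Rightarrow> (real \<times> 'a) measure" where
  "predictable_algebra M F =
     sigma ({0..} \<times> space M)
       ({{0} \<times> B | B. B \<in> sets (F 0)} \<union>
        {{s<..t} \<times> B | s t B. 0 \<le> s \<and> s \<le> t \<and> B \<in> sets (F s)})"

definition predictable ::
    "'a measure \<Rightarrow> (real \<Rightarrow> 'a measure) \<Rightarrow> (real \<Rightarrow> 'a \<Rightarrow> real) \<Rightarrow> bool" where
  "predictable M F X \<longleftrightarrow> (\<lambda>(t, \<omega>). X t \<omega>) \<in> borel_measurable (predictable_algebra M F)"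

definition nonneg_stopping_time ::
    "'a measure \<Rightarrow> (real \<Rightarrow> 'a measure) \<Rightarrow> ('a \<Rightarrow> real) \<Rightarrow> bool" where
  "nonneg_stopping_time M F \<tau> \<longleftrightarrow> stopping_time F \<tau> \<and> (\<forall>\<omega>\<in>space M. 0 \<le> \<tau> \<omega>)"

text \<open>\<open>\<tau>\<close> is predictable if the stochastic interval \<open>[\<tau>, \<infinity>)\<close> is a predictable set.\<close>

definition predictable_stopping_time ::
    "'a measure \<Rightarrow> (real \<Rightarrow> 'a measure) \<Rightarrow> ('a \<Rightarrow> real) \<Rightarrow> bool" where
  "predictable_stopping_time M F \<tau> \<longleftrightarrow>
     nonneg_stopping_time M F \<tau> \<and>
     {(t, \<omega>). 0 \<le> t \<and> \<omega> \<in> space M \<and> \<tau> \<omega> \<le> t} \<in> sets (predictable_algebra M F)"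

definition martingale ::
    "'a measure \<Rightarrow> (real \<Rightarrow> 'a measure) \<Rightarrow> (real \<Rightarrow> 'a \<Rightarrow> real) \<Rightarrow> bool" where
  "martingale M F X \<longleftrightarrow>
     adapted F X \<and> (\<forall>t\<ge>0. integrable M (X t)) \<and>
     (\<forall>s t. 0 \<le> s \<longrightarrow> s \<le> t \<longrightarrow> (AE \<omega> in M. real_cond_exp M (F s) (X t) \<omega> = X s \<omega>))"

text \<open>Taking the localizing stopping times finite is no restriction: replace
  \<open>\<sigma> n\<close> by \<open>min (\<sigma> n) n\<close>. The initial value is subtracted so that it need not be integrable.\<close>

definition local_martingale ::
    "'a measure \<Rightarrow> (real \<Rightarrow> 'a measure) \<Rightarrow> (real \<Rightarrow> 'a \<Rightarrow> real) \<Rightarrow> bool" where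
  "local_martingale M F X \<longleftrightarrow>
     adapted F X \<and>
     (\<exists>\<sigma> :: nat \<Rightarrow> 'a \<Rightarrow> real.
        (\<forall>n. nonneg_stopping_time M F (\<sigma> n)) \<and>
        (AE \<omega> in M. incseq (\<lambda>n. \<sigma> n \<omega>) \<and> filterlim (\<lambda>n. \<sigma> n \<omega>) at_top sequentially) \<and>
        (\<forall>n. martingale M F (\<lambda>t \<omega>. X (min t (\<sigma> n \<omega>)) \<omega> - X 0 \<omega>)))"


subsection \<open>Simple point processes and compensators\<close>

definition simple_point_process ::
    "'a measure \<Rightarrow> (real \<Rightarrow> 'a measure) \<Rightarrow> (real \<Rightarrow> 'a \<Rightarrow> real) \<Rightarrow> bool" where
  "simple_point_process M F N \<longleftrightarrow>
     adapted F N \<and>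
     (\<forall>\<omega>\<in>space M.
        (\<forall>t\<ge>0. continuous (at_right t) (\<lambda>u. N u \<omega>)) \<and>
        mono_on {0..} (\<lambda>u. N u \<omega>) \<and>
        (\<forall>t\<ge>0. N t \<omega> \<in> \<int>) \<and>
        N 0 \<omega> = 0 \<and>
        (\<forall>s>0. N s \<omega> - Lim (at_left s) (\<lambda>u. N u \<omega>) \<in> {0, 1}))"

definition is_compensator ::
    "'a measure \<Rightarrow> (real \<Rightarrow> 'a measure) \<Rightarrow> (real \<Rightarrow> 'a \<Rightarrow> real) \<Rightarrow> (real \<Rightarrow> 'a \<Rightarrow> real) \<Rightarrow> bool" where
  "is_compensator M F N A \<longleftrightarrow>
     predictable M F A \<and>
     (\<forall>\<omega>\<in>space M. mono_on {0..} (\<lambda>t. A t \<omega>) \<and> A 0 \<omega> = 0) \<and>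
     local_martingale M F (\<lambda>t \<omega>. N t \<omega> - A t \<omega>)"


subsection \<open>Cox processes\<close>

definition cond_indep_rv ::
    "'a measure \<Rightarrow> 'a measure \<Rightarrow> ('a \<Rightarrow> real) \<Rightarrow> ('a \<Rightarrow> real) \<Rightarrow> bool" where
  "cond_indep_rv M G X Y \<longleftrightarrow>
     (\<forall>B\<in>sets borel. \<forall>C\<in>sets borel. AE \<omega> in M.
        real_cond_exp M G (indicator {\<omega> \<in> space M. X \<omega> \<in> B \<and> Y \<omega> \<in> C}) \<omega> =
        real_cond_exp M G (indicator {\<omega> \<in> space M. X \<omega> \<in> B}) \<omega> *
        real_cond_exp M G (indicator {\<omega> \<in> space M. Y \<omega> \<in> C}) \<omega>)"

definition cox_process ::
    "'a measure \<Rightarrow> (real \<Rightarrow> 'a measure) \<Rightarrow> (real \<Rightarrow> 'a \<Rightarrow> real) \<Rightarrow> bool" where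
  "cox_process M F N \<longleftrightarrow>
     simple_point_process M F N \<and>
     (\<exists>A. is_compensator M F N A \<and>
       adapted F N \<and> adapted F A \<and>
       (\<forall>t\<ge>0. A t \<in> borel_measurable (F 0)) \<and>
       (\<forall>s t. \<forall>n::nat. 0 \<le> s \<longrightarrow> s < t \<longrightarrow> (AE \<omega> in M.
          real_cond_exp M (F s) (indicator {\<omega> \<in> space M. N t \<omega> - N s \<omega> = real n}) \<omega> =
          (A t \<omega> - A s \<omega>) ^ n * exp (A s \<omega> - A t \<omega>) / fact n)) \<and>
       (\<forall>s t u v. 0 \<le> s \<longrightarrow> s < t \<longrightarrow> t \<le> u \<longrightarrow> u < v \<longrightarrow>
          cond_indep_rv M (F 0) (\<lambda>\<omega>. N t \<omega> - N s \<omega>) (\<lambda>\<omega>. N u \<omega> - N v \<omega>)))"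


subsection \<open>Orderliness and intensity\<close>

text \<open>\<open>cond_prob_rate M G E r\<close> says that almost surely \<open>P(E h | G) / h \<rightarrow> r\<close> as
  \<open>h \<rightarrow> 0+\<close>. Each conditional probability is only determined up to a null set
  depending on \<open>h\<close>, so the limit over uncountably many \<open>h\<close> is required for
  some choice \<open>p h\<close> of versions.\<close>

definition is_cond_prob :: "'a measure \<Rightarrow> 'a measure \<Rightarrow> 'a set \<Rightarrow> ('a \<Rightarrow> real) \<Rightarrow> bool" where
  "is_cond_prob M G E p \<longleftrightarrow>
     p \<in> borel_measurable G \<and> (AE \<omega> in M. p \<omega> = real_cond_exp M G (indicator E) \<omega>)"

definition cond_prob_rate ::
    "'a measure \<Rightarrow> 'a measure \<Rightarrow> (real \<Rightarrow> 'a set) \<Rightarrow> ('a \<Rightarrow> real) \<Rightarrow> bool" where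
  "cond_prob_rate M G E r \<longleftrightarrow>
     (\<exists>p. (\<forall>h>0. is_cond_prob M G (E h) (p h)) \<and>
          (AE \<omega> in M. ((\<lambda>h. p h \<omega> / h) \<longlongrightarrow> r \<omega>) (at_right 0)))"

definition orderly ::
    "'a measure \<Rightarrow> (real \<Rightarrow> 'a measure) \<Rightarrow> (real \<Rightarrow> 'a \<Rightarrow> real) \<Rightarrow> bool" where
  "orderly M F N \<longleftrightarrow>
     (\<forall>\<tau>. nonneg_stopping_time M F \<tau> \<longrightarrow>
        cond_prob_rate M (filtration.pre_sigma (space M) F \<tau>)
          (\<lambda>h. {\<omega> \<in> space M. N (\<tau> \<omega> + h) \<omega> - N (\<tau> \<omega>) \<omega> > 1}) (\<lambda>\<omega>. 0))"

definition is_intensity ::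
    "'a measure \<Rightarrow> (real \<Rightarrow> 'a measure) \<Rightarrow> (real \<Rightarrow> 'a \<Rightarrow> real) \<Rightarrow> (real \<Rightarrow> 'a \<Rightarrow> real) \<Rightarrow> bool" where
  "is_intensity M F N l \<longleftrightarrow>
     (\<forall>t\<ge>0. l t \<in> borel_measurable M) \<and>
     (\<forall>\<omega>\<in>space M. \<forall>t\<ge>0. 0 \<le> l t \<omega>) \<and>
     (\<forall>\<tau>. predictable_stopping_time M F \<tau> \<longrightarrow>
        cond_prob_rate M (filtration.pre_sigma (space M) F \<tau>)
          (\<lambda>h. {\<omega> \<in> space M. N (\<tau> \<omega> + h) \<omega> - N (\<tau> \<omega>) \<omega> = 1}) (\<lambda>\<omega>. l (\<tau> \<omega>) \<omega>))"


subsection \<open>Hawkes processes\<close>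

text \<open>The arrival time \<open>T\<^sub>n\<close> is infinite if there are fewer than \<open>n\<close> arrivals, and
  \<open>T\<^sub>0 = 0\<close>. Hence at every \<open>t > 0\<close> the index \<open>n = 0\<close> contributes the term \<open>\<phi> t\<close> to
  the sum in the intensity below.\<close>

definition arrival_time :: "(real \<Rightarrow> 'a \<Rightarrow> real) \<Rightarrow> nat \<Rightarrow> 'a \<Rightarrow> ereal" where
  "arrival_time N n \<omega> = (INF t\<in>{t. 0 \<le> t \<and> real n \<le> N t \<omega>}. ereal t)"

definition hawkes_process ::
    "'a measure \<Rightarrow> (real \<Rightarrow> 'a measure) \<Rightarrow> (real \<Rightarrow> 'a \<Rightarrow> real) \<Rightarrow> (real \<Rightarrow> real) \<Rightarrow> (real \<Rightarrow> real) \<Rightarrow> bool" where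
  "hawkes_process M F N \<mu> \<phi> \<longleftrightarrow>
     (\<forall>t\<ge>0. 0 \<le> \<mu> t) \<and>
     (\<forall>t\<ge>0. set_integrable lebesgue {0..t} \<mu>) \<and>
     (\<forall>t\<ge>0. 0 \<le> \<phi> t) \<and>
     continuous_on {0..} \<phi> \<and>
     set_integrable lebesgue {0..} \<phi> \<and>
     (\<forall>t<0. \<phi> t = 0) \<and>
     simple_point_process M F N \<and>
     orderly M F N \<and>
     (\<exists>l. is_intensity M F N l \<and>
        (\<forall>\<omega>\<in>space M. \<forall>t\<ge>0.
           l t \<omega> = \<mu> t + (\<Sum>n | arrival_time N n \<omega> < ereal t.
                             \<phi> (t - real_of_ereal (arrival_time N n \<omega>)))))"

end

theory Submission
  imports Defs
begin

text \<open>The two descriptions of \<open>N\<close> disagree about what the intensity at a fixed time \<open>t > 0\<close> may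
  depend on. By (C2) the intensity is a limit of difference quotients built from the compensator, so
  it is almost surely equal to a random variable \<open>G\<close> measurable with respect to \<open>F 0\<close>
  (\<open>cox_intensity_known_at_time_zero\<close>). For a Hawkes process it depends on the past arrivals, and on
  the event \<open>N t = 0\<close> it takes the deterministic value \<open>\<mu> t + \<phi> t\<close>. But (C2) also says that this
  event has the conditional probability \<open>exp (- A t) > 0\<close> given \<open>F 0\<close>, whatever \<open>F 0\<close> reveals.
  The event \<open>G \<noteq> \<mu> t + \<phi> t\<close> belongs to \<open>F 0\<close>, so if it had positive probability it would meet
  \<open>N t = 0\<close>, which is impossible. Hence the intensity at \<open>t\<close> is almost surely \<open>\<mu> t + \<phi> t\<close>, also when
  there were arrivals (\<open>cox_hawkes_intensity_deterministic\<close>), and all later arrivals contribute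
  nothing to it.

  If there is an arrival with positive probability, then some outcome has a first arrival \<open>T\<^sub>1 < \<infinity>\<close>
  and vanishing contributions at all rational times; so \<open>\<phi> (q - T\<^sub>1) = 0\<close> for all rational
  \<open>q > T\<^sub>1\<close>, and \<open>\<phi> = 0\<close> by continuity. If there is almost surely no arrival, then the intensity
  is zero, and \<open>\<mu> t + \<phi> t = 0\<close> for all \<open>t > 0\<close> forces \<open>\<phi> = 0\<close> as well: the term \<open>\<phi> t\<close> is present
  because \<open>T\<^sub>0 = 0\<close> counts as an arrival.\<close>

section \<open>Conditional expectations and continuity\<close>

lemma real_cond_exp_cong_sets:
  assumes "space G = space H" "sets G = sets H"
  shows "real_cond_exp M G f = real_cond_exp M H f"
proof -
  have "subalgebra M G = subalgebra M H"
    using assms by (simp add: subalgebra_def)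
  moreover have "restr_to_subalg K G = restr_to_subalg K H" for K :: "'a measure"
    using assms by (simp add: restr_to_subalg_def)
  ultimately show ?thesis
    by (simp add: real_cond_exp_def nn_cond_exp_def)
qed

text \<open>An event of positive conditional probability given \<open>F\<close> meets every non-null set of \<open>F\<close>. So
  an \<open>F\<close>-measurable property that holds on such an event holds almost surely.\<close>

lemma (in finite_measure_subalgebra) AE_in_if_AE_on_positive_cond_prob:
  assumes E: "E \<in> sets M" and B: "B \<in> sets F"
    and pos: "AE x in M. 0 < real_cond_exp M F (indicator E) x"
    and sub: "AE x in M. x \<in> E \<longrightarrow> x \<in> B"
  shows "AE x in M. x \<in> B"
proof -
  define C where "C = space M - B"
  have sp: "space F = space M"
    using subalg by (simp add: subalgebra_def)
  have C: "C \<in> sets F"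
    unfolding C_def using sets.compl_sets[OF B] by (simp add: sp)
  have CM: "C \<in> sets M"
    using C subalg by (auto simp: subalgebra_def)
  have int: "integrable M (indicator E :: 'a \<Rightarrow> real)"
    using E by (simp add: emeasure_eq_measure)
  have intC: "integrable M (\<lambda>x. indicator C x * real_cond_exp M F (indicator E) x)"
    using integrable_mult_indicator[OF CM real_cond_exp_int(1)[OF int]] by simp
  have "(LINT x:C|M. real_cond_exp M F (indicator E) x) = (LINT x:C|M. indicator E x)"
    using real_cond_exp_intA[OF int C] by simp
  also have "\<dots> = (LINT x|M. 0)"
    unfolding set_lebesgue_integral_def
  proof (rule integral_cong_AE)
    show "(\<lambda>x. indicator C x *\<^sub>R indicator E x :: real) \<in> borel_measurable M"
      using E CM by measurable
    show "AE x in M. indicator C x *\<^sub>R indicator E x = (0 :: real)"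
      using sub by eventually_elim (auto simp: C_def indicator_def)
  qed simp
  finally have "(LINT x|M. indicator C x * real_cond_exp M F (indicator E) x) = 0"
    by (simp add: set_lebesgue_integral_def)
  moreover have "AE x in M. 0 \<le> indicator C x * real_cond_exp M F (indicator E) x"
    using pos by eventually_elim (simp add: indicator_def)
  ultimately have "AE x in M. indicator C x * real_cond_exp M F (indicator E) x = 0"
    using integral_nonneg_eq_0_iff_AE[OF intC] by simp
  then show ?thesis
    using pos AE_space by eventually_elim (auto simp: C_def indicator_def split: if_splits)
qed

lemma continuous_on_zero_if_right_dense_zeros:
  fixes f :: "real \<Rightarrow> real"
  assumes cont: "continuous_on {0..} f"
    and dense: "\<And>x d. 0 \<le> x \<Longrightarrow> 0 < d \<Longrightarrow> \<exists>y. x < y \<and> y < x + d \<and> f y = 0"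
    and x: "0 \<le> x"
  shows "f x = 0"
proof (rule ccontr)
  assume nz: "f x \<noteq> 0"
  then obtain d where d: "d > 0"
    and near: "\<And>y. y \<in> {0..} \<Longrightarrow> dist y x < d \<Longrightarrow> dist (f y) (f x) < \<bar>f x\<bar>"
    using cont x unfolding continuous_on_iff by (metis atLeast_iff zero_less_abs_iff)
  obtain y where y: "x < y" "y < x + d" "f y = 0"
    using dense[OF x d] by blast
  then show False
    using near[of y] x by (simp add: dist_real_def)
qed

section \<open>Arrival times\<close>

lemma arrival_time_0:
  assumes "N 0 \<omega> = 0"
  shows "arrival_time N 0 \<omega> = 0"
proof (rule antisym)
  show "arrival_time N 0 \<omega> \<le> 0"
    unfolding arrival_time_def using assms by (intro INF_lower2[of 0]) auto
qed (auto simp: arrival_time_def intro!: INF_greatest)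

lemma arrival_time_nonneg: "0 \<le> arrival_time N n \<omega>"
  by (auto simp: arrival_time_def intro!: INF_greatest)

lemma arrival_time_le:
  assumes "0 \<le> t" "real n \<le> N t \<omega>"
  shows "arrival_time N n \<omega> \<le> ereal t"
  unfolding arrival_time_def using assms by (intro INF_lower) auto

lemma count_ge_if_arrival_time_less:
  assumes mono: "mono_on {0..} (\<lambda>u. N u \<omega>)" and less: "arrival_time N n \<omega> < ereal t"
  shows "real n \<le> N t \<omega>"
proof -
  obtain s where "0 \<le> s" "real n \<le> N s \<omega>" "s < t"
    using less unfolding arrival_time_def by (auto simp: INF_less_iff)
  then show ?thesis
    using mono_onD[OF mono, of s t] by auto
qed

text \<open>An infinite index set would turn the sum of the self-excitation into \<open>0\<close>. It cannot
  occur, since the indices of the arrivals before \<open>t\<close> are at most \<open>N t\<close>.\<close>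

lemma finite_arrivals_before:
  assumes "mono_on {0..} (\<lambda>u. N u \<omega>)"
  shows "finite {n. arrival_time N n \<omega> < ereal t}"
proof (rule finite_subset)
  show "{n. arrival_time N n \<omega> < ereal t} \<subseteq> {..nat \<lfloor>N t \<omega>\<rfloor>}"
    using count_ge_if_arrival_time_less[of N \<omega>, OF assms] by (auto simp: le_nat_floor)
qed simp

lemma arrivals_before_if_count_0:
  assumes "mono_on {0..} (\<lambda>u. N u \<omega>)" "N 0 \<omega> = 0" "N t \<omega> = 0" "0 < t"
  shows "{n. arrival_time N n \<omega> < ereal t} = {0}"
  using count_ge_if_arrival_time_less[of N \<omega> _ t, OF assms(1)] assms(3,4)
    arrival_time_0[of N \<omega>, OF assms(2)]
  by fastforce

text \<open>All terms of the sum are non-negative, and those of \<open>T\<^sub>0 = 0\<close> and \<open>T\<^sub>1 = T\<close> are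
  \<open>\<phi> t\<close> and \<open>\<phi> (t - T)\<close>. If the sum is only \<open>\<phi> t\<close>, this forces \<open>\<phi> (t - T) = 0\<close>.\<close>

lemma first_two_arrival_terms_le_sum:
  fixes \<phi> :: "real \<Rightarrow> real"
  assumes mono: "mono_on {0..} (\<lambda>u. N u \<omega>)" and "N 0 \<omega> = 0"
    and \<phi>: "\<forall>t\<ge>0. 0 \<le> \<phi> t"
    and T: "arrival_time N 1 \<omega> = ereal T" "T < t"
  shows "\<phi> t + \<phi> (t - T)
    \<le> (\<Sum>n | arrival_time N n \<omega> < ereal t. \<phi> (t - real_of_ereal (arrival_time N n \<omega>)))"
proof -
  let ?g = "\<lambda>n. \<phi> (t - real_of_ereal (arrival_time N n \<omega>))"
  have T0: "0 \<le> T"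
    using arrival_time_nonneg[of N 1 \<omega>] T by simp
  have nonneg: "0 \<le> ?g n" if "arrival_time N n \<omega> < ereal t" for n
    using that arrival_time_nonneg[of N n \<omega>] \<phi>
    by (cases "arrival_time N n \<omega>") auto
  have "\<phi> t + \<phi> (t - T) = sum ?g {0, 1}"
    using T arrival_time_0[of N \<omega>, OF assms(2)] by simp
  also have "\<dots> \<le> sum ?g {n. arrival_time N n \<omega> < ereal t}"
  proof (rule sum_mono2)
    show "finite {n. arrival_time N n \<omega> < ereal t}"
      by (rule finite_arrivals_before[of N \<omega>, OF mono])
    show "{0, 1} \<subseteq> {n. arrival_time N n \<omega> < ereal t}"
      using T T0 arrival_time_0[of N \<omega>, OF assms(2)] by simp
  qed (use nonneg in blast)
  finally show ?thesis .
qed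

section \<open>The intensity at a fixed time\<close>

context filtered_prob_space
begin

lemma finite_measure_subalgebra_F: "finite_measure_subalgebra M (F t)"
  by unfold_locales (rule subalgebra_F)

lemma adapted_measurable:
  assumes "adapted F X" "0 \<le> t"
  shows "X t \<in> borel_measurable M"
  using assms measurable_from_subalg[OF subalgebra_F] unfolding adapted_def by blast

lemma sets_pre_sigma_const: "sets (pre_sigma (\<lambda>_. t)) = sets (F t)"
proof -
  have "{\<omega> \<in> A. t \<le> s} \<in> sets (F s)" if "A \<in> sets (F t)" for A s
    using that sets_F_mono[of t s] by (cases "t \<le> s") auto
  moreover have "A \<in> sets (F t)" if "\<forall>s. {\<omega> \<in> A. t \<le> s} \<in> sets (F s)" for A
    using that[rule_format, of t] by simp
  ultimately show ?thesis
    unfolding sets_pre_sigma[OF stopping_time_const] by blast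
qed

text \<open>Both \<open>[0,\<infinity>) \<times> space M\<close> and \<open>[0,t) \<times> space M\<close> are countable unions of generators of the
  predictable \<open>\<sigma>\<close>-algebra; the stochastic interval of the constant time \<open>t\<close> is their difference.\<close>

lemma predictable_stopping_time_const:
  assumes t: "0 \<le> t"
  shows "predictable_stopping_time M F (\<lambda>_. t)"
proof -
  let ?P = "predictable_algebra M F"
  let ?G = "{{0} \<times> B | B. B \<in> sets (F 0)} \<union>
    {{s<..u} \<times> B | s u B. 0 \<le> s \<and> s \<le> u \<and> B \<in> sets (F s)}"
  have "?G \<subseteq> Pow ({0..} \<times> space M)"
    using subalgebra_F sets.sets_into_space unfolding subalgebra_def by fastforce
  then have gen: "X \<in> sets ?P" if "X \<in> ?G" for X
    using that unfolding predictable_algebra_def by (auto intro: in_measure_of)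
  have top: "space M \<in> sets (F s)" for s
    using sets.top[of "F s"] by (simp add: space_F)
  have after: "{s<..} \<times> space M \<in> sets ?P" if "0 \<le> s" for s
  proof -
    have "(\<Union>n. {s<..s + real n} \<times> space M) \<in> sets ?P"
    proof (intro sets.countable_UN image_subsetI gen)
      fix n
      have "s \<le> s + real n"
        by simp
      then show "{s<..s + real n} \<times> space M \<in> ?G"
        using that top by blast
    qed
    moreover have "(\<Union>n. {s<..s + real n} \<times> space M) = {s<..} \<times> space M"
    proof -
      have "\<exists>n. u \<le> s + real n" for u
        using real_arch_simple[of "u - s"] by (auto simp: algebra_simps)
      then show ?thesis by fastforce
    qed
    ultimately show ?thesis by simp
  qed
  have zero: "{0} \<times> space M \<in> sets ?P"
    using top by (intro gen) auto
  have all: "{0..} \<times> space M \<in> sets ?P"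
  proof -
    have "{0 :: real..} \<times> space M = {0} \<times> space M \<union> {0<..} \<times> space M"
      by (auto simp: less_le)
    then show ?thesis
      using zero after[of 0] by auto
  qed
  have before: "{0..<t} \<times> space M \<in> sets ?P"
  proof (cases "t = 0")
    case False
    have "(\<Union>n. {0<..t - t / real (Suc n)} \<times> space M) \<in> sets ?P"
    proof (intro sets.countable_UN image_subsetI gen)
      fix n
      have "0 \<le> t - t / real (Suc n)"
        using t by (simp add: field_simps)
      then show "{0<..t - t / real (Suc n)} \<times> space M \<in> ?G"
        using top order_refl[of "0 :: real"] by blast
    qed
    moreover have "{0..<t} \<times> space M =
      {0} \<times> space M \<union> (\<Union>n. {0<..t - t / real (Suc n)} \<times> space M)"
    proof -
      have "\<exists>n. u \<le> t - t / real (Suc n)" if "u < t" for u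
      proof -
        obtain n where n: "t / (t - u) < real n"
          using reals_Archimedean2 by blast
        have "t < real n * (t - u)"
          using n that by (simp add: field_simps)
        also have "\<dots> \<le> real (Suc n) * (t - u)"
          using that by (intro mult_right_mono) auto
        finally have "t / real (Suc n) \<le> t - u"
          by (simp add: pos_divide_le_eq mult.commute)
        then have "u \<le> t - t / real (Suc n)"
          by linarith
        then show ?thesis ..
      qed
      moreover have "u < t" if "u \<le> t - t / real (Suc n)" for u n
      proof -
        have "0 < t / real (Suc n)"
          using t False by simp
        with that show ?thesis by linarith
      qed
      ultimately have less_iff: "u < t \<longleftrightarrow> (\<exists>n. u \<le> t - t / real (Suc n))" for u
        by blast
      have "{0..<t} = {0} \<union> (\<Union>n. {0<..t - t / real (Suc n)})"
      proof (rule set_eqI)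
        fix u
        show "u \<in> {0..<t} \<longleftrightarrow> u \<in> {0} \<union> (\<Union>n. {0<..t - t / real (Suc n)})"
          using t False less_iff[of u] by (cases "u = 0") (auto simp del: of_nat_Suc)
      qed
      then show ?thesis
        by (simp only:) blast
    qed
    ultimately show ?thesis
      using zero by auto
  qed simp
  have "{(s, \<omega>). 0 \<le> s \<and> \<omega> \<in> space M \<and> t \<le> s} = {0..} \<times> space M - {0..<t} \<times> space M"
    by auto
  then have "{(s, \<omega>). 0 \<le> s \<and> \<omega> \<in> space M \<and> t \<le> s} \<in> sets ?P"
    using all before by auto
  then show ?thesis
    using t by (simp add: predictable_stopping_time_def nonneg_stopping_time_def stopping_time_const)
qed

text \<open>A sequence of step sizes avoids the choice of versions of the conditional probabilities: only
  countably many null sets have to be removed.\<close>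

lemma intensity_at_fixed_time:
  assumes l: "is_intensity M F N l" and t: "0 \<le> t"
  shows "AE \<omega> in M. (\<lambda>n. real_cond_exp M (F t)
      (indicator {\<omega> \<in> space M. N (t + 1 / real (Suc n)) \<omega> - N t \<omega> = 1}) \<omega> / (1 / real (Suc n)))
    \<longlonglongrightarrow> l t \<omega>"
proof -
  let ?E = "\<lambda>h. {\<omega> \<in> space M. N (t + h) \<omega> - N t \<omega> = 1}"
  let ?G = "pre_sigma (\<lambda>_. t)"
  have "cond_prob_rate M ?G ?E (l t)"
    using l predictable_stopping_time_const[OF t] unfolding is_intensity_def by auto
  then obtain p where p: "\<And>h. h > 0 \<Longrightarrow> is_cond_prob M ?G (?E h) (p h)"
    and lim: "AE \<omega> in M. ((\<lambda>h. p h \<omega> / h) \<longlongrightarrow> l t \<omega>) (at_right 0)"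
    unfolding cond_prob_rate_def by blast
  have cond_exp: "real_cond_exp M ?G f = real_cond_exp M (F t) f" for f
    by (rule real_cond_exp_cong_sets) (simp_all add: space_pre_sigma space_F sets_pre_sigma_const)
  have "AE \<omega> in M. \<forall>n. p (1 / real (Suc n)) \<omega> =
      real_cond_exp M (F t) (indicator (?E (1 / real (Suc n)))) \<omega>"
    using p by (simp add: AE_all_countable is_cond_prob_def cond_exp)
  then show ?thesis
    using lim
  proof eventually_elim
    case (elim \<omega>)
    have "filterlim (\<lambda>n. 1 / real (Suc n)) (at_right 0) sequentially"
      unfolding filterlim_at using LIMSEQ_Suc[OF lim_1_over_n] by (auto intro: always_eventually)
    from filterlim_compose[OF elim(2) this] show ?case
      using elim(1) by simp
  qed
qed

text \<open>The difference quotients of \<open>P(N (t + h) - N t = 1 | F t)\<close> involve only the compensator,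
  which \<open>F 0\<close> already knows, and this passes to their limit.\<close>

lemma cox_intensity_known_at_time_zero:
  assumes l: "is_intensity M F N l" and t: "0 \<le> t"
    and A: "\<forall>t\<ge>0. A t \<in> borel_measurable (F 0)"
    and C2: "\<And>s t n. 0 \<le> s \<Longrightarrow> s < t \<Longrightarrow> (AE \<omega> in M.
          real_cond_exp M (F s) (indicator {\<omega> \<in> space M. N t \<omega> - N s \<omega> = real n}) \<omega> =
          (A t \<omega> - A s \<omega>) ^ n * exp (A s \<omega> - A t \<omega>) / fact n)"
  shows "\<exists>G \<in> borel_measurable (F 0). AE \<omega> in M. l t \<omega> = G \<omega>"
proof
  let ?h = "\<lambda>n. 1 / real (Suc n)"
  define q where "q n \<omega> = (A (t + ?h n) \<omega> - A t \<omega>) * exp (A t \<omega> - A (t + ?h n) \<omega>) / ?h n" for n \<omega>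
  show "(\<lambda>\<omega>. lim (\<lambda>n. q n \<omega>)) \<in> borel_measurable (F 0)"
  proof (rule borel_measurable_lim_metric)
    fix n
    have [measurable]: "A t \<in> borel_measurable (F 0)" "A (t + ?h n) \<in> borel_measurable (F 0)"
      using A t by auto
    show "q n \<in> borel_measurable (F 0)"
      unfolding q_def by measurable
  qed
  have "AE \<omega> in M. \<forall>n. real_cond_exp M (F t)
      (indicator {\<omega> \<in> space M. N (t + ?h n) \<omega> - N t \<omega> = 1}) \<omega> =
      (A (t + ?h n) \<omega> - A t \<omega>) * exp (A t \<omega> - A (t + ?h n) \<omega>)"
    unfolding AE_all_countable
  proof
    fix n
    show "AE \<omega> in M. real_cond_exp M (F t)
      (indicator {\<omega> \<in> space M. N (t + ?h n) \<omega> - N t \<omega> = 1}) \<omega> =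
      (A (t + ?h n) \<omega> - A t \<omega>) * exp (A t \<omega> - A (t + ?h n) \<omega>)"
      using C2[of t "t + ?h n" 1] t by simp
  qed
  with intensity_at_fixed_time[OF l t] show "AE \<omega> in M. l t \<omega> = lim (\<lambda>n. q n \<omega>)"
  proof eventually_elim
    case (elim \<omega>)
    have "(\<lambda>n. q n \<omega>) \<longlonglongrightarrow> l t \<omega>"
      using elim(1) unfolding q_def elim(2)[rule_format] .
    then show ?case
      by (simp add: limI)
  qed
qed

text \<open>On the event \<open>N t = 0\<close> only \<open>T\<^sub>0 = 0\<close> lies before \<open>t\<close>, so the intensity is \<open>\<mu> t + \<phi> t\<close> there;
  knowledge of \<open>F 0\<close> cannot exclude this event.\<close>

lemma cox_hawkes_intensity_deterministic:
  assumes cox: "cox_process M F N" and l: "is_intensity M F N l" and t: "0 < t"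
    and hawkes: "\<forall>\<omega>\<in>space M. \<forall>t\<ge>0. l t \<omega> = \<mu> t +
      (\<Sum>n | arrival_time N n \<omega> < ereal t. \<phi> (t - real_of_ereal (arrival_time N n \<omega>)))"
  shows "AE \<omega> in M. l t \<omega> = \<mu> t + \<phi> t"
proof -
  obtain A where A0: "\<And>\<omega>. \<omega> \<in> space M \<Longrightarrow> A 0 \<omega> = 0"
    and A: "\<forall>t\<ge>0. A t \<in> borel_measurable (F 0)"
    and C2: "\<And>s t n. 0 \<le> s \<Longrightarrow> s < t \<Longrightarrow> (AE \<omega> in M.
          real_cond_exp M (F s) (indicator {\<omega> \<in> space M. N t \<omega> - N s \<omega> = real n}) \<omega> =
          (A t \<omega> - A s \<omega>) ^ n * exp (A s \<omega> - A t \<omega>) / fact n)"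
    using cox unfolding cox_process_def is_compensator_def by blast
  have adapted: "adapted F N"
    and N: "\<And>\<omega>. \<omega> \<in> space M \<Longrightarrow> mono_on {0..} (\<lambda>u. N u \<omega>) \<and> N 0 \<omega> = 0"
    using cox unfolding cox_process_def simple_point_process_def by auto
  have t0: "0 \<le> t"
    using t by simp
  obtain G where G [measurable]: "G \<in> borel_measurable (F 0)" and lG: "AE \<omega> in M. l t \<omega> = G \<omega>"
    using cox_intensity_known_at_time_zero[OF l t0 A C2] by blast
  let ?E = "{\<omega> \<in> space M. N t \<omega> - N 0 \<omega> = real 0}"
  let ?B = "{\<omega> \<in> space (F 0). G \<omega> = \<mu> t + \<phi> t}"
  interpret F0: finite_measure_subalgebra M "F 0"
    by (rule finite_measure_subalgebra_F)
  have [measurable]: "N t \<in> borel_measurable M" "N 0 \<in> borel_measurable M"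
    using adapted_measurable[OF adapted] t by auto
  have "AE \<omega> in M. \<omega> \<in> ?B"
  proof (rule F0.AE_in_if_AE_on_positive_cond_prob[of ?E])
    show "AE \<omega> in M. 0 < real_cond_exp M (F 0) (indicator ?E) \<omega>"
      using C2[OF order_refl t, of 0] by eventually_elim simp
    show "AE \<omega> in M. \<omega> \<in> ?E \<longrightarrow> \<omega> \<in> ?B"
      using lG AE_space
    proof eventually_elim
      case (elim \<omega>)
      show ?case
      proof
        assume "\<omega> \<in> ?E"
        with N elim(2) have "mono_on {0..} (\<lambda>u. N u \<omega>)" "N 0 \<omega> = 0" "N t \<omega> = 0"
          by auto
        from arrivals_before_if_count_0[of N \<omega>, OF this t] arrival_time_0[of N \<omega>, OF this(2)]
        have "l t \<omega> = \<mu> t + \<phi> t"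
          using hawkes elim(2) t by simp
        then show "\<omega> \<in> ?B"
          using elim by (simp add: space_F)
      qed
    qed
  qed measurable
  with lG show ?thesis
    by eventually_elim simp
qed

lemma intensity_eq_0_if_no_arrivals:
  assumes l: "is_intensity M F N l" and adapted: "adapted F N" and t: "0 \<le> t"
    and zero: "\<And>s. 0 \<le> s \<Longrightarrow> AE \<omega> in M. N s \<omega> = 0"
  shows "AE \<omega> in M. l t \<omega> = 0"
proof -
  let ?h = "\<lambda>n. 1 / real (Suc n)"
  let ?E = "\<lambda>n. {\<omega> \<in> space M. N (t + ?h n) \<omega> - N t \<omega> = 1}"
  interpret Ft: finite_measure_subalgebra M "F t"
    by (rule finite_measure_subalgebra_F)
  have "AE \<omega> in M. \<forall>n. real_cond_exp M (F t) (indicator (?E n)) \<omega> = 0"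
    unfolding AE_all_countable
  proof
    fix n
    have [measurable]: "N (t + ?h n) \<in> borel_measurable M" "N t \<in> borel_measurable M"
      using adapted_measurable[OF adapted] t by auto
    have "AE \<omega> in M. indicator (?E n) \<omega> = (0 :: real)"
      using zero[of t] zero[of "t + ?h n"] t by (auto simp: indicator_def)
    then have "AE \<omega> in M. real_cond_exp M (F t) (indicator (?E n)) \<omega> = real_cond_exp M (F t) (\<lambda>_. 0) \<omega>"
      by (rule Ft.real_cond_exp_cong) measurable
    moreover have "AE \<omega> in M. real_cond_exp M (F t) (\<lambda>_. 0) \<omega> = 0"
      by (rule Ft.real_cond_exp_F_meas) simp_all
    ultimately show "AE \<omega> in M. real_cond_exp M (F t) (indicator (?E n)) \<omega> = 0"
      by eventually_elim simp
  qed
  with intensity_at_fixed_time[OF l t] show ?thesis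
  proof eventually_elim
    case (elim \<omega>)
    have "(\<lambda>n. 0) \<longlonglongrightarrow> l t \<omega>"
      using elim(1) unfolding elim(2)[rule_format] by simp
    then show ?case
      by (simp add: LIMSEQ_const_iff)
  qed
qed

end

section \<open>A Cox process is not self-exciting\<close>

theorem theorem4:
  fixes M :: "'a measure" and F :: "real \<Rightarrow> 'a measure"
    and N :: "real \<Rightarrow> 'a \<Rightarrow> real" and \<mu> \<phi> :: "real \<Rightarrow> real"
  assumes "filtered_prob_space M F"
    and "cox_process M F N"
    and "hawkes_process M F N \<mu> \<phi>"
  shows "\<forall>t. \<phi> t = 0"
proof -
  interpret filtered_prob_space M F
    by fact
  have \<mu>: "\<forall>t\<ge>0. 0 \<le> \<mu> t" and \<phi>: "\<forall>t\<ge>0. 0 \<le> \<phi> t" and cont: "continuous_on {0..} \<phi>"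
    and neg: "\<forall>t<0. \<phi> t = 0" and N: "simple_point_process M F N"
    using assms(3) unfolding hawkes_process_def by auto
  obtain l where l: "is_intensity M F N l"
    and hawkes: "\<forall>\<omega>\<in>space M. \<forall>t\<ge>0. l t \<omega> = \<mu> t +
      (\<Sum>n | arrival_time N n \<omega> < ereal t. \<phi> (t - real_of_ereal (arrival_time N n \<omega>)))"
    using assms(3) unfolding hawkes_process_def by blast
  have det: "AE \<omega> in M. l t \<omega> = \<mu> t + \<phi> t" if "0 < t" for t
    using cox_hawkes_intensity_deterministic[OF assms(2) l that hawkes] .
  have "\<exists>y. x < y \<and> y < x + d \<and> \<phi> y = 0" if x: "0 \<le> x" and d: "0 < d" for x d
  proof (cases "\<forall>s\<ge>0. AE \<omega> in M. N s \<omega> = 0")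
    case True
    let ?y = "x + d / 2"
    have pos: "0 < ?y"
      using x d by simp
    have "AE \<omega> in M. l ?y \<omega> = 0"
      using intensity_eq_0_if_no_arrivals[OF l] N True pos
      unfolding simple_point_process_def by auto
    with det[OF pos] have "AE \<omega> in M. \<mu> ?y + \<phi> ?y = 0"
      by eventually_elim simp
    then have "\<mu> ?y + \<phi> ?y = 0"
      by (simp add: AE_const)
    moreover have "0 \<le> \<mu> ?y" "0 \<le> \<phi> ?y"
      using \<mu> \<phi> pos by (auto intro: less_imp_le)
    ultimately have "\<phi> ?y = 0"
      by linarith
    then show ?thesis
      using d by (intro exI[of _ ?y]) auto
  next
    case False
    then obtain s where s: "0 \<le> s" "\<not> (AE \<omega> in M. N s \<omega> = 0)"
      by blast
    \<comment> \<open>Rational times suffice for the density argument, and they cost only countably many null sets.\<close>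
    have good: "AE \<omega> in M. \<forall>q::rat. 0 < q \<longrightarrow> l (of_rat q) \<omega> = \<mu> (of_rat q) + \<phi> (of_rat q)"
      unfolding AE_all_countable using det by auto
    have "\<exists>\<omega>\<in>space M. N s \<omega> \<noteq> 0 \<and>
        (\<forall>q::rat. 0 < q \<longrightarrow> l (of_rat q) \<omega> = \<mu> (of_rat q) + \<phi> (of_rat q))"
    proof (rule ccontr)
      assume none: "\<not> ?thesis"
      have "AE \<omega> in M. N s \<omega> = 0"
        using good AE_space by eventually_elim (use none in blast)
      with s(2) show False ..
    qed
    then obtain \<omega> where \<omega>: "\<omega> \<in> space M" and Ns: "N s \<omega> \<noteq> 0"
      and rat: "\<And>q::rat. 0 < q \<Longrightarrow> l (of_rat q) \<omega> = \<mu> (of_rat q) + \<phi> (of_rat q)"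
      by blast
    have path: "mono_on {0..} (\<lambda>u. N u \<omega>)" "N 0 \<omega> = 0" "N s \<omega> \<in> \<int>"
      using N \<omega> s(1) unfolding simple_point_process_def by auto
    have "0 \<le> N s \<omega>"
      using mono_onD[OF path(1), of 0 s] path(2) s(1) by simp
    then have "1 \<le> N s \<omega>"
      using Ns path(3) by (auto elim!: Ints_cases)
    then have "arrival_time N 1 \<omega> \<le> ereal s"
      using s(1) by (intro arrival_time_le) auto
    then obtain T where T: "arrival_time N 1 \<omega> = ereal T" "0 \<le> T"
      using arrival_time_nonneg[of N 1 \<omega>] by (cases "arrival_time N 1 \<omega>") auto
    \<comment> \<open>The zero of \<open>\<phi>\<close> sits at \<open>q - T\<close>, so \<open>q\<close> is taken from the target interval shifted by \<open>T\<close>.\<close>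
    obtain q :: rat where q: "T + x < of_rat q" "of_rat q < T + x + d"
      using of_rat_dense[of "T + x" "T + x + d"] d by auto
    have q0: "(0::real) < of_rat q" "T < of_rat q"
      using q(1) T(2) x by linarith+
    have "\<phi> (of_rat q) + \<phi> (of_rat q - T) \<le> \<phi> (of_rat q)"
      using first_two_arrival_terms_le_sum[of N \<omega>, OF path(1,2) \<phi> T(1) q0(2)]
        hawkes[rule_format, OF \<omega>, of "of_rat q"] rat[of q] q0(1) by simp
    moreover have "0 \<le> \<phi> (of_rat q - T)"
      using \<phi> q0(2) by auto
    ultimately have "\<phi> (of_rat q - T) = 0"
      by linarith
    then show ?thesis
      using q by (intro exI[of _ "of_rat q - T"]) auto
  qed
  then have "\<phi> t = 0" if "0 \<le> t" for t
    using continuous_on_zero_if_right_dense_zeros[OF cont _ that] by blast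
  with neg show ?thesis
    by (meson not_le)
qed

end
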